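(* Let $\ell\geq k\geq2$ and let $\tau$ be a base $k$ term of the notation system $\mathcal L=\{0,\,x+y,\,x\cdot y,\,k^x\}$. Then $|\uparrow^{\ell}\tau|\leq|\uparrow^{\ell}\mathrm{nf}_k(\tau)|$, where $\mathrm{nf}_k$ denotes the hereditary exponential normal form (which uses only $0$, $+$ and $k^x$).
   Context: For $k\ge2$, the base $k$ terms of $\mathcal L$ form the least set containing the constant $0$ and closed under $\sigma,\tau\mapsto\sigma+\tau$, $\sigma,\tau\mapsto\sigma\cdot\tau$ and $\tau\mapsto k^\tau$ (base-$k$ exponentiation is a unary operation). The value $|\tau|\in\mathbb N$ is the natural number obtained by evaluating the term. The base change $\uparrow^\ell\tau$ of a base $k$ term is the base $\ell$ term defined by $\uparrow^\ell0=0$, $\uparrow^\ell(\sigma+\tau)=\uparrow^\ell\sigma+\uparrow^\ell\tau$, $\uparrow^\ell(\sigma\cdot\tau)=\uparrow^\ell\sigma\cdot\uparrow^\ell\tau$, $\uparrow^\ell(k^\tau)=\ell^{\uparrow^\ell\tau}$. The hereditary exponential normal form is defined by $\mathrm{nf}_k(0)=0$ and, for $n>0$, letting $r$ be the unique natural number with $k^r\le n<k^{r+1}$ and $b=n-k^r$, $\mathrm{nf}_k(n)=k^{\mathrm{nf}_k(r)}+\mathrm{nf}_k(b)$ (a summand $\mathrm{nf}_k(b)=0$ is omitted). For a term $\tau$, $\mathrm{nf}_k(\tau)=\mathrm{nf}_k(|\tau|)$. *)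

theory Defs
  imports Main
begin

text \<open>The base is recorded at each exponential, so that base \<open>k\<close> terms for different \<open>k\<close>
  are different terms of one datatype, and base change is a map between them.\<close>

datatype trm = Zero | Add trm trm | Mul trm trm | Exp nat trm

inductive_set base_terms :: "nat \<Rightarrow> trm set" for k :: nat where
  Zero: "Zero \<in> base_terms k"
| Add: "\<sigma> \<in> base_terms k \<Longrightarrow> \<tau> \<in> base_terms k \<Longrightarrow> Add \<sigma> \<tau> \<in> base_terms k"
| Mul: "\<sigma> \<in> base_terms k \<Longrightarrow> \<tau> \<in> base_terms k \<Longrightarrow> Mul \<sigma> \<tau> \<in> base_terms k"
| Exp: "\<tau> \<in> base_terms k \<Longrightarrow> Exp k \<tau> \<in> base_terms k"

primrec val :: "trm \<Rightarrow> nat" where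
  "val Zero = 0"
| "val (Add \<sigma> \<tau>) = val \<sigma> + val \<tau>"
| "val (Mul \<sigma> \<tau>) = val \<sigma> * val \<tau>"
| "val (Exp k \<tau>) = k ^ val \<tau>"

primrec base_change :: "nat \<Rightarrow> trm \<Rightarrow> trm" where
  "base_change l Zero = Zero"
| "base_change l (Add \<sigma> \<tau>) = Add (base_change l \<sigma>) (base_change l \<tau>)"
| "base_change l (Mul \<sigma> \<tau>) = Mul (base_change l \<sigma>) (base_change l \<tau>)"
| "base_change l (Exp k \<tau>) = Exp l (base_change l \<tau>)"

definition lead_exp :: "nat \<Rightarrow> nat \<Rightarrow> nat" where
  "lead_exp k n = (THE r. k ^ r \<le> n \<and> n < k ^ (r + 1))"

lemma lead_exp_ex1:
  fixes k n :: nat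
  assumes "k \<ge> 2" "n > 0"
  shows "\<exists>!r. k ^ r \<le> n \<and> n < k ^ (r + 1)"
proof (rule ex_ex1I)
  show "\<exists>r. k ^ r \<le> n \<and> n < k ^ (r + 1)"
    using ex_power_ivl1[of k n] assms by simp
next
  fix r s
  assume r: "k ^ r \<le> n \<and> n < k ^ (r + 1)" and s: "k ^ s \<le> n \<and> n < k ^ (s + 1)"
  have "k ^ r < k ^ (s + 1)" "k ^ s < k ^ (r + 1)"
    using r s by linarith+
  then have "r < s + 1" "s < r + 1"
    using assms(1) by (simp_all only: power_strict_increasing_iff)
  then show "r = s" by simp
qed

lemma lead_exp_bounds:
  assumes "k \<ge> 2" "n > 0"
  shows "k ^ lead_exp k n \<le> n" "n < k ^ (lead_exp k n + 1)"
  using theI'[OF lead_exp_ex1[OF assms]] unfolding lead_exp_def by simp_all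

lemma lead_exp_less:
  assumes "k \<ge> 2" "n > 0"
  shows "lead_exp k n < n"
  using lead_exp_bounds(1)[OF assms] power_gt_expt[of k "lead_exp k n"] assms(1) by simp

text \<open>Only \<open>k \<ge> 2\<close> is meaningful; the guard \<open>k < 2\<close> makes the recursion total.\<close>

function nf :: "nat \<Rightarrow> nat \<Rightarrow> trm" where
  "nf k n =
    (if n = 0 \<or> k < 2 then Zero
     else let r = lead_exp k n; b = n - k ^ r
          in if b = 0 then Exp k (nf k r) else Add (Exp k (nf k r)) (nf k b))"
  by auto
termination
  by (relation "measure snd") (auto simp: lead_exp_less)

declare nf.simps [simp del]

definition nf_trm :: "nat \<Rightarrow> trm \<Rightarrow> trm" where
  "nf_trm k \<tau> = nf k (val \<tau>)"

lemma nf_in_base_terms: "nf k n \<in> base_terms k"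
  by (induction k n rule: nf.induct)
    (subst nf.simps, simp add: Let_def base_terms.intros)

lemma val_nf:
  assumes "k \<ge> 2"
  shows "val (nf k n) = n"
  using assms
proof (induction k n rule: nf.induct)
  case (1 k n)
  show ?case
  proof (cases "n = 0")
    case True
    then show ?thesis by (simp add: nf.simps)
  next
    case False
    then show ?thesis
      using 1 lead_exp_bounds(1)[of k n] by (subst nf.simps) (auto simp: Let_def)
  qed
qed

lemma base_change_in_base_terms: "\<tau> \<in> base_terms k \<Longrightarrow> base_change l \<tau> \<in> base_terms l"
  by (induction rule: base_terms.induct) (auto intro: base_terms.intros)

end

theory Submission imports Defs begin

text \<open>
  Write \<open>f n\<close> (\<open>nf_shift k l n\<close> in the code) for the value of \<open>nf k n\<close> after its base is changed to \<open>l\<close>. If \<open>n\<close> has the base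
  \<open>k\<close> digits \<open>d\<^sub>i\<close>, then \<open>f n\<close> is the sum of the \<open>d\<^sub>i * l ^ f i\<close>. The theorem follows by
  induction on the term once \<open>f\<close> is known to dominate each of the three operations:
  \<open>f m + f n \<le> f (m + n)\<close>, \<open>f m * f n \<le> f (m * n)\<close> and \<open>l ^ f n = f (k ^ n)\<close>. The last is
  immediate, because the normal form of \<open>k ^ n\<close> is the single exponential of \<open>nf k n\<close>.

  Addition of numbers agrees with addition of digits except where a carry replaces \<open>k\<close> copies of
  \<open>k ^ i\<close> by one \<open>k ^ (i + 1)\<close>. Under \<open>f\<close> this replaces \<open>k * l ^ f i\<close> by \<open>l ^ f (i + 1)\<close>, which
  is at least \<open>l * l ^ f i\<close> because \<open>f\<close> is strictly increasing; so, as \<open>k \<le> l\<close>, a carry can only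
  increase the value. The strict increase is itself an instance of superadditivity, but at the
  exponent \<open>i\<close>, which is smaller than \<open>k ^ i\<close>. Hence both are obtained together, by induction on
  the number of digits, in lemma \<open>nf_shift_add_power\<close>; there one summand is a power of \<open>k\<close>, and
  the general case follows by splitting powers off one by one.

  For products, distributivity and superadditivity reduce the claim to two powers of \<open>k\<close>, where
  \<open>l ^ f i * l ^ f j = l ^ (f i + f j) \<le> l ^ f (i + j)\<close> by superadditivity on the exponents.
\<close>

definition nf_shift :: "nat \<Rightarrow> nat \<Rightarrow> nat \<Rightarrow> nat" where
  "nf_shift k l n = val (base_change l (nf k n))"

lemma nf_shift_zero [simp]: "nf_shift k l 0 = 0"
  by (simp add: nf_shift_def nf.simps)

lemma lead_exp_eqI:
  assumes "k \<ge> 2" "k ^ r \<le> n" "n < k ^ (r + 1)"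
  shows "lead_exp k n = r"
proof -
  have "n > 0"
    using assms(1,2) by (auto intro: gr0I)
  then show ?thesis
    using lead_exp_ex1[OF assms(1)] lead_exp_bounds[OF assms(1)] assms(2,3) by blast
qed

lemma nf_shift_lead:
  assumes "k \<ge> 2" "k ^ r + b < k ^ (r + 1)"
  shows "nf_shift k l (k ^ r + b) = l ^ nf_shift k l r + nf_shift k l b"
proof -
  have "lead_exp k (k ^ r + b) = r"
    using assms by (intro lead_exp_eqI) auto
  then show ?thesis
    using assms(1) unfolding nf_shift_def
    by (subst nf.simps) (auto simp: Let_def nf.simps[of k 0])
qed

lemma nf_shift_power:
  assumes "k \<ge> 2"
  shows "nf_shift k l (k ^ r) = l ^ nf_shift k l r"
  using nf_shift_lead[of k r 0 l] assms by simp

lemma add_power_less_next_power: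
  fixes k b r :: nat
  assumes "k \<ge> 2" "b < k ^ r"
  shows "k ^ r + b < k ^ (r + 1)"
proof -
  have "k ^ r + b < 2 * k ^ r"
    using assms(2) by simp
  also have "\<dots> \<le> k * k ^ r"
    using assms(1) by (rule mult_le_mono1)
  finally show ?thesis by simp
qed

text \<open>This induction follows the recursion of the normal form: the bound in the step makes
  \<open>k ^ r\<close> the leading power, so that \<open>nf_shift_lead\<close> computes the shift exactly.\<close>

lemma power_split_induct [consumes 1, case_names zero split]:
  fixes k n :: nat
  assumes "k \<ge> 2" "P 0"
    and "\<And>r b. k ^ r + b < k ^ (r + 1) \<Longrightarrow> P b \<Longrightarrow> P (k ^ r + b)"
  shows "P n"
proof (induction n rule: less_induct)
  case (less n)
  show ?case
  proof (cases "n = 0")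
    case False
    define b where "b = n - k ^ lead_exp k n"
    have "n = k ^ lead_exp k n + b"
      using False lead_exp_bounds(1)[OF assms(1)] by (simp add: b_def)
    moreover have "b < n"
      using False assms(1) by (simp add: b_def)
    moreover have "n < k ^ (lead_exp k n + 1)"
      using False lead_exp_bounds(2)[OF assms(1)] by simp
    ultimately show ?thesis
      using less.IH assms(3) by metis
  qed (simp add: assms(2))
qed

lemma nf_shift_digit:
  assumes "k \<ge> 2" "b < k ^ s" "d < k"
  shows "nf_shift k l (d * k ^ s + b) = d * l ^ nf_shift k l s + nf_shift k l b"
  using assms(3)
proof (induction d)
  case (Suc d)
  have "(d + 2) * k ^ s \<le> k * k ^ s"
    using Suc.prems by (intro mult_le_mono1) simp
  then have "k ^ s + (d * k ^ s + b) < k ^ (s + 1)"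
    using assms(2) by (simp add: algebra_simps)
  from nf_shift_lead[OF assms(1) this] show ?case
    using Suc by (simp add: algebra_simps)
qed simp

text \<open>The digit value \<open>d = k\<close> is a carry. The strict increase of the shift at \<open>s\<close> is a hypothesis
  because it is available only for the exponents already treated when the lemma is used inside
  the induction below.\<close>

lemma nf_shift_digit_carry:
  assumes "k \<ge> 2" "k \<le> l" "b < k ^ s" "d \<le> k"
    and incr: "nf_shift k l s < nf_shift k l (s + 1)"
  shows "d * l ^ nf_shift k l s + nf_shift k l b \<le> nf_shift k l (d * k ^ s + b)"
proof (cases "d = k")
  case True
  have "b < k ^ (s + 1)"
    using add_power_less_next_power[OF assms(1,3)] by simp
  then have "nf_shift k l (d * k ^ s + b) = l ^ nf_shift k l (s + 1) + nf_shift k l b"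
    using True nf_shift_lead[OF assms(1) add_power_less_next_power[OF assms(1)], of b "s + 1" l]
    by simp
  moreover have "k * l ^ nf_shift k l s \<le> l ^ nf_shift k l (s + 1)"
  proof -
    have "k * l ^ nf_shift k l s \<le> l ^ Suc (nf_shift k l s)"
      using assms(2) by simp
    also have "\<dots> \<le> l ^ nf_shift k l (s + 1)"
      using incr assms(1,2) by (intro power_increasing) auto
    finally show ?thesis .
  qed
  ultimately show ?thesis
    using True by simp
next
  case False
  then show ?thesis
    using nf_shift_digit[OF assms(1,3)] assms(4) by simp
qed

text \<open>Induction on a bound \<open>t\<close> for the number of digits of \<open>n\<close>. A power below the leading
  position is first added to the lower digits, which may send a carry \<open>e \<le> 1\<close> to the top.\<close>

lemma nf_shift_add_power:
  assumes "k \<ge> 2" "k \<le> l"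
  shows "l ^ nf_shift k l r + nf_shift k l n \<le> nf_shift k l (k ^ r + n)"
proof -
  let ?f = "nf_shift k l"
  have "l ^ ?f r + ?f n \<le> ?f (k ^ r + n)" if "n < k ^ t" for t r n
    using that
  proof (induction t arbitrary: r n)
    case 0
    then show ?case
      by (simp add: nf_shift_power[OF assms(1)])
  next
    case (Suc s)
    \<comment> \<open>The induction hypothesis for \<open>k ^ 0 + s\<close>, available since \<open>s < k ^ s\<close>.\<close>
    have incr: "?f s < ?f (s + 1)"
      using Suc.IH[of s 0] power_gt_expt[of k s] assms(1) by simp
    define d b where "d = n div k ^ s" and "b = n mod k ^ s"
    have n: "n = d * k ^ s + b" and b: "b < k ^ s"
      using assms(1) by (simp_all only: d_def b_def div_mult_mod_eq) simp
    have d: "d < k"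
      using Suc.prems by (simp add: d_def less_mult_imp_div_less)
    have f_n: "?f n = d * l ^ ?f s + ?f b"
      unfolding n by (rule nf_shift_digit[OF assms(1) b d])
    consider "r < s" | "r = s" | "Suc s \<le> r" by linarith
    then show ?case
    proof cases
      case 1
      define e c where "e = (k ^ r + b) div k ^ s" and "c = (k ^ r + b) mod k ^ s"
      have rb: "k ^ r + b = e * k ^ s + c" and c: "c < k ^ s"
        using assms(1) by (simp_all only: e_def c_def div_mult_mod_eq) simp
      have "k ^ r < k ^ s"
        using 1 assms(1) by simp
      then have "k ^ r + b < 2 * k ^ s"
        using b by simp
      then have e: "e < 2"
        unfolding e_def by (rule less_mult_imp_div_less)
      have "l ^ ?f r + ?f b \<le> ?f (k ^ r + b)"
        by (rule Suc.IH[OF b])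
      also have "\<dots> = e * l ^ ?f s + ?f c"
        unfolding rb using e assms(1) by (intro nf_shift_digit[OF assms(1) c]) simp
      finally have "l ^ ?f r + ?f n \<le> (d + e) * l ^ ?f s + ?f c"
        using f_n by (simp add: algebra_simps)
      also have "\<dots> \<le> ?f ((d + e) * k ^ s + c)"
        using d e by (intro nf_shift_digit_carry[OF assms c _ incr]) simp
      also have "(d + e) * k ^ s + c = k ^ r + n"
        using rb n by (simp add: algebra_simps)
      finally show ?thesis .
    next
      case 2
      have "l ^ ?f r + ?f n = (d + 1) * l ^ ?f s + ?f b"
        using f_n 2 by simp
      also have "\<dots> \<le> ?f ((d + 1) * k ^ s + b)"
        using d by (intro nf_shift_digit_carry[OF assms b _ incr]) simp
      also have "(d + 1) * k ^ s + b = k ^ r + n"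
        using n 2 by simp
      finally show ?thesis .
    next
      case 3
      then have "k ^ Suc s \<le> k ^ r"
        using assms(1) by (intro power_increasing) auto
      then have "k ^ r + n < k ^ (r + 1)"
        using Suc.prems assms(1) by (intro add_power_less_next_power) simp_all
      then show ?thesis
        by (simp add: nf_shift_lead[OF assms(1)])
    qed
  qed
  moreover have "n < k ^ n"
    using assms(1) by (simp add: power_gt_expt)
  ultimately show ?thesis .
qed

lemma nf_shift_superadditive:
  assumes "k \<ge> 2" "k \<le> l"
  shows "nf_shift k l m + nf_shift k l n \<le> nf_shift k l (m + n)"
  using assms(1)
proof (induction m rule: power_split_induct)
  case (split r b)
  then show ?case
    using nf_shift_add_power[OF assms, of r "b + n"] nf_shift_lead[OF assms(1) split(1), of l]
    by (simp add: add.assoc)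
qed simp

lemma nf_shift_mult_power:
  assumes "k \<ge> 2" "k \<le> l"
  shows "nf_shift k l m * l ^ nf_shift k l r \<le> nf_shift k l (m * k ^ r)"
  using assms(1)
proof (induction m rule: power_split_induct)
  case (split s b)
  let ?f = "nf_shift k l"
  have "?f (k ^ s + b) * l ^ ?f r = l ^ (?f s + ?f r) + ?f b * l ^ ?f r"
    by (simp only: nf_shift_lead[OF assms(1) split(1)] distrib_right power_add)
  also have "\<dots> \<le> l ^ ?f (s + r) + ?f (b * k ^ r)"
    using assms split(2) nf_shift_superadditive[OF assms]
    by (intro add_mono power_increasing) auto
  also have "\<dots> \<le> ?f (k ^ (s + r) + b * k ^ r)"
    by (rule nf_shift_add_power[OF assms])
  also have "k ^ (s + r) + b * k ^ r = (k ^ s + b) * k ^ r"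
    by (simp add: algebra_simps power_add)
  finally show ?case .
qed simp

lemma nf_shift_supermultiplicative:
  assumes "k \<ge> 2" "k \<le> l"
  shows "nf_shift k l m * nf_shift k l n \<le> nf_shift k l (m * n)"
  using assms(1)
proof (induction n rule: power_split_induct)
  case (split r b)
  let ?f = "nf_shift k l"
  have "?f m * ?f (k ^ r + b) = ?f m * l ^ ?f r + ?f m * ?f b"
    by (simp only: nf_shift_lead[OF assms(1) split(1)] distrib_left)
  also have "\<dots> \<le> ?f (m * k ^ r) + ?f (m * b)"
    using nf_shift_mult_power[OF assms] split(2) by (rule add_mono)
  also have "\<dots> \<le> ?f (m * (k ^ r + b))"
    using nf_shift_superadditive[OF assms, of "m * k ^ r"] by (simp add: distrib_left)
  finally show ?case .
qed simp

theorem theorem6p1: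
  fixes k l :: nat and \<tau> :: trm
  assumes "l \<ge> k" and "k \<ge> 2" and "\<tau> \<in> base_terms k"
  shows "val (base_change l \<tau>) \<le> val (base_change l (nf_trm k \<tau>))"
proof -
  let ?f = "nf_shift k l"
  have "val (base_change l \<tau>) \<le> ?f (val \<tau>)"
    using assms(3)
  proof induction
    case Zero
    then show ?case by simp
  next
    case (Add \<sigma> \<tau>)
    then show ?case
      using nf_shift_superadditive[OF assms(2,1), of "val \<sigma>" "val \<tau>"] by simp
  next
    case (Mul \<sigma> \<tau>)
    have "val (base_change l \<sigma>) * val (base_change l \<tau>) \<le> ?f (val \<sigma>) * ?f (val \<tau>)"
      using Mul.IH by (rule mult_le_mono)
    also have "\<dots> \<le> ?f (val \<sigma> * val \<tau>)"
      by (rule nf_shift_supermultiplicative[OF assms(2,1)])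
    finally show ?case by simp
  next
    case (Exp \<tau>)
    then show ?case
      using assms(1,2) by (simp add: nf_shift_power power_increasing)
  qed
  then show ?thesis
    by (simp add: nf_shift_def nf_trm_def)
qed

end
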